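(* Let $\{x_1,x_2\}$ be a frame for $\mathbb{R}^2$ (with two vectors). Then for every non-trivial orthogonal projection $P:\mathbb{R}^2\to\mathbb{R}^2$, the frame $\{x_1,x_2\}$ is piecewise scalable with the projection $P$; that is, there exist real constants $a_1,a_2,b_1,b_2$ such that $\{a_iPx_i+b_i(I-P)x_i\}_{i=1}^2$ is a Parseval frame for $\mathbb{R}^2$.
   Context: A finite family $\{x_i\}_{i=1}^m$ in a finite-dimensional real inner product space $H$ is a frame for $H$ if there are constants $0<A\le B<\infty$ with $A\|x\|^2\le\sum_{i=1}^m|\langle x,x_i\rangle|^2\le B\|x\|^2$ for all $x\in H$ (equivalently, the family spans $H$). It is a Parseval frame for $H$ if $\sum_{i=1}^m|\langle x,x_i\rangle|^2=\|x\|^2$ for all $x\in H$. An orthogonal projection is a linear map $P$ with $P\circ P=P$ and $P^*=P$; it is non-trivial if $P\neq 0$ and $P\ne I$, where $I$ is the identity. *)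

theory Defs
  imports "HOL-Analysis.Analysis"
begin

text \<open>A finite family \<open>(x\<^sub>i)\<close>, \<open>i = 1, \<dots>, m\<close>, is a function on \<open>nat\<close> of which only the
  values on \<open>{1..m}\<close> matter; repeated vectors are allowed.\<close>

definition is_frame :: "nat \<Rightarrow> (nat \<Rightarrow> 'a::euclidean_space) \<Rightarrow> bool" where
  "is_frame m x \<longleftrightarrow>
     (\<exists>A B :: real. 0 < A \<and> A \<le> B \<and>
        (\<forall>v. A * (norm v)\<^sup>2 \<le> (\<Sum>i=1..m. \<bar>v \<bullet> x i\<bar>\<^sup>2) \<and>
             (\<Sum>i=1..m. \<bar>v \<bullet> x i\<bar>\<^sup>2) \<le> B * (norm v)\<^sup>2))"

definition is_parseval_frame :: "nat \<Rightarrow> (nat \<Rightarrow> 'a::euclidean_space) \<Rightarrow> bool" where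
  "is_parseval_frame m x \<longleftrightarrow> (\<forall>v. (\<Sum>i=1..m. \<bar>v \<bullet> x i\<bar>\<^sup>2) = (norm v)\<^sup>2)"

definition orthogonal_projection :: "('a::euclidean_space \<Rightarrow> 'a) \<Rightarrow> bool" where
  "orthogonal_projection P \<longleftrightarrow> linear P \<and> P \<circ> P = P \<and> adjoint P = P"

definition nontrivial_projection :: "('a::euclidean_space \<Rightarrow> 'a) \<Rightarrow> bool" where
  "nontrivial_projection P \<longleftrightarrow> orthogonal_projection P \<and> P \<noteq> (\<lambda>v. 0) \<and> P \<noteq> id"

definition piecewise_scalable_with ::
    "nat \<Rightarrow> (nat \<Rightarrow> 'a::euclidean_space) \<Rightarrow> ('a \<Rightarrow> 'a) \<Rightarrow> bool" where
  "piecewise_scalable_with m x P \<longleftrightarrow>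
     (\<exists>a b :: nat \<Rightarrow> real.
        is_parseval_frame m (\<lambda>i. a i *\<^sub>R P (x i) + b i *\<^sub>R (x i - P (x i))))"

end

(* Since x 1 and x 2 span the plane, either P (x 1) and (I - P) (x 2) are both nonzero, or
   P (x 2) and (I - P) (x 1) are. Such a pair is orthogonal, so after normalising it and
   discarding the other two pieces (zero coefficients) one is left with an orthonormal basis. *)

theory Submission
  imports Defs
begin

text \<open>The residual \<open>r\<close> left after removing the components of \<open>v\<close>
  along \<open>e\<close> and \<open>f\<close> is orthogonal to both. If it were nonzero,
  \<open>r\<close>, \<open>e\<close>, \<open>f\<close> would be three independent vectors in
  dimension two.\<close>

lemma orthonormal_pair_parseval:
  fixes e f v :: "'a::euclidean_space"
  assumes "DIM('a) = 2" "norm e = 1" "norm f = 1" "e \<bullet> f = 0"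
  shows "(v \<bullet> e)\<^sup>2 + (v \<bullet> f)\<^sup>2 = (norm v)\<^sup>2"
proof -
  define r where "r = v - (v \<bullet> e) *\<^sub>R e - (v \<bullet> f) *\<^sub>R f"
  have ee: "e \<bullet> e = 1" "f \<bullet> f = 1" "f \<bullet> e = 0"
    using assms by (simp_all add: norm_eq_1 inner_commute)
  have re: "r \<bullet> e = 0" "r \<bullet> f = 0"
    using ee assms(4) by (simp_all add: r_def inner_diff_left)
  have "r = 0"
  proof (rule ccontr)
    assume r: "r \<noteq> 0"
    have ne: "e \<noteq> f" "r \<noteq> e" "r \<noteq> f" using ee re assms(4) by auto
    have "independent {r, e, f}"
    proof (rule pairwise_orthogonal_independent)
      show "pairwise orthogonal {r, e, f}"
        using re ee assms(4) by (auto simp: pairwise_def orthogonal_def inner_commute)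
      show "0 \<notin> {r, e, f}" using r assms by auto
    qed
    then have "card {r, e, f} \<le> DIM('a)"
      using independent_bound by blast
    then show False using ne assms(1) by simp
  qed
  then have v: "v = (v \<bullet> e) *\<^sub>R e + (v \<bullet> f) *\<^sub>R f" by (simp add: r_def diff_eq_eq add.commute)
  have "(norm v)\<^sup>2 = v \<bullet> v" by (simp add: power2_norm_eq_inner)
  also have "\<dots> = v \<bullet> ((v \<bullet> e) *\<^sub>R e + (v \<bullet> f) *\<^sub>R f)" using v by simp
  also have "\<dots> = (v \<bullet> e)\<^sup>2 + (v \<bullet> f)\<^sup>2" by (simp add: inner_add_right power2_eq_square)
  finally show ?thesis by simp
qed

lemma sum_1_2: "(\<Sum>i=1..2. g i) = g 1 + g (2::nat)" for g :: "nat \<Rightarrow> 'a::comm_monoid_add"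
  by (simp add: numeral_2_eq_2)

lemma orthogonal_projection_inner:
  assumes "orthogonal_projection P"
  shows "P v \<bullet> w = v \<bullet> P w"
  using assms adjoint_works[of P v w] by (simp add: orthogonal_projection_def)

text \<open>Self-adjointness turns \<open>P v \<bullet> w\<close> into
  \<open>v \<bullet> P w\<close>, and together with idempotence it does the same for
  \<open>P v \<bullet> P w\<close>.\<close>

lemma orthogonal_projection_inner_complement:
  assumes "orthogonal_projection P"
  shows "P v \<bullet> (w - P w) = 0"
proof -
  have "P (P w) = P w"
    using assms by (metis comp_apply orthogonal_projection_def)
  then show ?thesis
    using orthogonal_projection_inner[OF assms, of v w] orthogonal_projection_inner[OF assms, of v "P w"]
    by (simp add: inner_diff_right)
qed

text \<open>This is the lower frame bound: a vector orthogonal to the whole family makes the sum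
  vanish, while \<open>A > 0\<close> keeps the bound positive.\<close>

lemma is_frame_separates:
  assumes "is_frame m x" "v \<noteq> 0"
  shows "\<exists>i\<in>{1..m}. v \<bullet> x i \<noteq> 0"
proof (rule ccontr)
  assume "\<not> ?thesis"
  then have "(\<Sum>i=1..m. \<bar>v \<bullet> x i\<bar>\<^sup>2) = 0" by simp
  moreover obtain A where "A > 0" "A * (norm v)\<^sup>2 \<le> (\<Sum>i=1..m. \<bar>v \<bullet> x i\<bar>\<^sup>2)"
    using assms(1) unfolding is_frame_def by blast
  ultimately show False
    using assms(2) by (simp add: mult_le_0_iff)
qed

text \<open>The indices \<open>i\<close> and \<open>j\<close> stay symbolic because both orders of 1
  and 2 occur in the final case split.\<close>

lemma piecewise_scalable_with_pairI:
  fixes x :: "nat \<Rightarrow> 'a::euclidean_space"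
  assumes "DIM('a) = 2" "orthogonal_projection P" "{i, j} = {1, 2}"
    and "P (x i) \<noteq> 0" "x j \<noteq> P (x j)"
  shows "piecewise_scalable_with 2 x P"
proof -
  \<comment> \<open>Only the range piece of \<open>x i\<close> and the complementary piece of
    \<open>x j\<close> survive, each scaled to unit length.\<close>
  define a where "a = (\<lambda>k. if k = i then inverse (norm (P (x i))) else 0)"
  define b where "b = (\<lambda>k. if k = j then inverse (norm (x j - P (x j))) else 0)"
  define y where "y = (\<lambda>k. a k *\<^sub>R P (x k) + b k *\<^sub>R (x k - P (x k)))"
  have ij: "i = 1 \<and> j = 2 \<or> i = 2 \<and> j = 1" using assms(3) by (auto simp: doubleton_eq_iff)
  have yi: "y i = sgn (P (x i))" and yj: "y j = sgn (x j - P (x j))"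
    using ij by (auto simp: y_def a_def b_def sgn_div_norm)
  have "norm (y i) = 1" "norm (y j) = 1" "y i \<bullet> y j = 0"
    using assms(4,5) orthogonal_projection_inner_complement[OF assms(2), of "x i" "x j"]
    unfolding yi yj by (simp_all add: norm_sgn sgn_div_norm)
  then have "(v \<bullet> y i)\<^sup>2 + (v \<bullet> y j)\<^sup>2 = (norm v)\<^sup>2" for v
    using orthonormal_pair_parseval[OF assms(1)] by blast
  then have "is_parseval_frame 2 y"
    using ij unfolding is_parseval_frame_def sum_1_2 by (auto simp: add.commute)
  then show ?thesis
    unfolding piecewise_scalable_with_def y_def by blast
qed

theorem theorem1p4:
  fixes x :: "nat \<Rightarrow> real ^ 2"
  assumes "is_frame 2 x"
  shows "\<forall>P :: real ^ 2 \<Rightarrow> real ^ 2. nontrivial_projection P \<longrightarrow> piecewise_scalable_with 2 x P"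
proof (intro allI impI)
  fix P :: "real ^ 2 \<Rightarrow> real ^ 2"
  assume "nontrivial_projection P"
  then have P: "orthogonal_projection P" and "P \<noteq> (\<lambda>v. 0)" "P \<noteq> id"
    by (auto simp: nontrivial_projection_def)
  then obtain z z' where z: "P z \<noteq> 0" "z' - P z' \<noteq> 0" by fastforce
  have sep: "v \<bullet> x 1 \<noteq> 0 \<or> v \<bullet> x 2 \<noteq> 0" if "v \<noteq> 0" for v
  proof -
    have "{1..2} = {1, 2::nat}" by auto
    then show ?thesis using is_frame_separates[OF assms that] by simp
  qed
  \<comment> \<open>If one vector vanished, the other would by \<open>sep\<close> be orthogonal to
    no nonzero vector, which is impossible in the plane.\<close>
  have nonzero: "x 1 \<noteq> 0 \<and> x 2 \<noteq> 0"
  proof (rule ccontr)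
    assume "\<not> ?thesis"
    then have "\<exists>w. \<forall>v::real ^ 2. v \<noteq> 0 \<longrightarrow> v \<bullet> w \<noteq> 0" using sep by fastforce
    then obtain w where w: "\<And>v::real ^ 2. v \<noteq> 0 \<Longrightarrow> v \<bullet> w \<noteq> 0" by blast
    obtain v :: "real ^ 2" where "v \<noteq> 0" "orthogonal w v"
      using orthogonal_to_vector_exists[of w] by auto
    then show False using w by (simp add: orthogonal_def inner_commute)
  qed
  \<comment> \<open>Test the frame against \<open>P z\<close> and move \<open>P\<close> across the
    inner product.\<close>
  have range: "P (x 1) \<noteq> 0 \<or> P (x 2) \<noteq> 0"
    using sep[OF z(1)] by (auto simp: orthogonal_projection_inner[OF P])
  \<comment> \<open>If \<open>P\<close> fixed both frame vectors, both would be orthogonal to the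
    nonzero vector \<open>z' - P z'\<close>.\<close>
  have kernel: "x 1 \<noteq> P (x 1) \<or> x 2 \<noteq> P (x 2)"
    using sep[OF z(2)] orthogonal_projection_inner_complement[OF P, of _ z']
    by (metis inner_commute)
  \<comment> \<open>Suppose the first alternative fails. If \<open>P (x 1) = 0\<close>, then
    \<open>x 1 \<noteq> P (x 1)\<close> by \<open>nonzero\<close>, and \<open>range\<close> gives
    \<open>P (x 2) \<noteq> 0\<close>. If \<open>x 2 = P (x 2)\<close>, then
    \<open>P (x 2) \<noteq> 0\<close> by \<open>nonzero\<close>, and \<open>kernel\<close> gives the
    rest.\<close>
  have "P (x 1) \<noteq> 0 \<and> x 2 \<noteq> P (x 2) \<or> P (x 2) \<noteq> 0 \<and> x 1 \<noteq> P (x 1)"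
    using nonzero range kernel by metis
  then show "piecewise_scalable_with 2 x P"
    using piecewise_scalable_with_pairI[OF _ P, of 1 2 x]
      piecewise_scalable_with_pairI[OF _ P, of 2 1 x] by auto
qed

end
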